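(* Let $n\ge0$ and assume $\omega_i^n\in\Omega$ for all $i\in\mathbb{Z}$. Assume that at each interface, with left state $\omega^L=\omega_i^n$ and right state $\omega^R=\omega_{i+1}^n$, the intermediate states of the approximate Riemann solver satisfy $\rho^{L*},\rho^{R*},e^{L*},e^{R*}>0$, and that the relaxation speeds satisfy $$a^L b^L > p(\tau^L,e^L)\,\partial_e p(\tau^L,e^L)-\partial_\tau p(\tau^L,e^L),\qquad a^L b^L > p(\tau^{L*},e^{L*})\,\partial_e p(\tau^{L*},e^{L*})-\partial_\tau p(\tau^{L*},e^{L*}),$$ $$a^R b^R > p(\tau^{R*},e^{R*})\,\partial_e p(\tau^{R*},e^{R*})-\partial_\tau p(\tau^{R*},e^{R*}),\qquad a^R b^R > p(\tau^R,e^R)\,\partial_e p(\tau^R,e^R)-\partial_\tau p(\tau^R,e^R).$$ Assume moreover that the pressure law is such that, for every fixed pair $(I,J)$, the function $\tau\mapsto f_{I,J}(\tau)$ is strictly convex. Then the relaxation scheme using the approximate Riemann solver $W_{\mathcal R}$, under the CFL condition, preserves the positivity of the internal energy: $e_i^{n+1}>0$ for all $i\in\mathbb{Z}$.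
   Context: Model. One-dimensional dimensionless Euler equations with gravity, Mach number $M>0$, given smooth potential $\Phi$: $\partial_t\rho+\partial_x(\rho u)=0$, $\partial_t(\rho u)+\partial_x(\rho u^2+p/M^2)=-\frac{1}{M^2}\rho\,\partial_x\Phi$, $\partial_t E+\partial_x((E+p)u)=-\rho u\,\partial_x\Phi$, with $E=\rho e+\frac12M^2\rho u^2$, $\tau=1/\rho$, smooth pressure law $p=p(\tau,e)$. Phase space $\Omega=\{\omega=(\rho,\rho u,E):\rho>0,e>0\}$; $F(\omega)=(\rho u,\rho u^2+p/M^2,(E+p)u)$. There is a specific entropy $s(\tau,e):\mathbb{R}^+\times\mathbb{R}^+\to\mathbb{R}^+$, strictly convex, with $-T\,ds=de+p\,d\tau$ for a temperature $T(\tau,e)>0$. Approximate Riemann solver. Given $\omega^L,\omega^R\in\Omega$ and potential values $\Phi^L,\Phi^R$, put (relaxation equilibrium) $\pi^\alpha=p(\tau^\alpha,e^\alpha)$, $v^\alpha=u^\alpha$, $Z^\alpha=\Phi^\alpha$, $\alpha\in\{L,R\}$; a state is $W=(\rho,\rho u,E,\rho\pi,\rho v,\rho Z,a,b)$. Relaxation speeds $a^\alpha,b^\alpha>0$ with $a^\alpha\ge b^\alpha$ are given at each interface. $\bar\rho=\bar\rho(W^L,W^R)$ is a density average with $\bar\rho=\rho$ if $\rho^L=\rho^R=\rho$. With $\Delta=\bar\rho\,(Z^R-Z^L)$, the intermediate states are $v^*=\frac{Mb^Lv^L+Mb^Rv^R+\pi^L-\pi^R-\Delta}{M(b^L+b^R)}$,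 $\frac1{\rho^{L*}}=\frac1{\rho^L}+\frac{Mb^R(v^R-v^L)+\pi^L-\pi^R-\Delta}{a^L(b^L+b^R)}$, $\frac1{\rho^{R*}}=\frac1{\rho^R}+\frac{Mb^L(v^R-v^L)+\pi^R-\pi^L+\Delta}{a^R(b^L+b^R)}$, $u^{L*}=u^L+\frac{b^L(Mb^R(v^R-v^L)+\pi^L-\pi^R-\Delta)}{Ma^L(b^L+b^R)}$, $u^{R*}=u^R+\frac{b^R(Mb^L(v^L-v^R)+\pi^L-\pi^R-\Delta)}{Ma^R(b^L+b^R)}$, $\pi^{L*}=\frac{b^R\pi^L+b^L\pi^R+Mb^Lb^R(v^L-v^R)+b^L\Delta}{b^L+b^R}$, $\pi^{R*}=\frac{b^R\pi^L+b^L\pi^R+Mb^Lb^R(v^L-v^R)-b^R\Delta}{b^L+b^R}$, $e^{\alpha*}=e^\alpha+\frac{(\pi^{\alpha*})^2-(\pi^\alpha)^2}{2a^\alpha b^\alpha}+\frac{M^2[(v^*-u^{\alpha*})^2-(v^\alpha-u^\alpha)^2]}{2(a^\alpha/b^\alpha-1)}$ (last quotient read as $0$ if $a^\alpha=b^\alpha$), $a^{\alpha*}=a^\alpha$, $b^{\alpha*}=b^\alpha$, $Z^{\alpha*}=Z^\alpha$; $\tau^{\alpha*}=1/\rho^{\alpha*}$, $E^{\alpha*}=\rho^{\alpha*}e^{\alpha*}+\frac12M^2\rho^{\alpha*}(u^{\alpha*})^2$. The wave speeds are $\sigma^-=v^L-\frac{a^L}{M\rho^L}$, $\sigma^v=v^*$,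 $\sigma^+=v^R+\frac{a^R}{M\rho^R}$, and $W_{\mathcal R}(x/t;W^L,W^R)$ equals $W^L,W^{L*},W^{R*},W^R$ for $x/t<\sigma^-$, $\sigma^-<x/t<\sigma^v$, $\sigma^v<x/t<\sigma^+$, $\sigma^+<x/t$ respectively. Relaxation scheme. Uniform grid with cells of size $\Delta x$ and time step $\Delta t$. The numerical flux $F(\omega^L,\Phi^L,\omega^R,\Phi^R)$ equals $F(\omega^L)$ if $\sigma^->0$; $F^{L*}$ if $\sigma^-<0\le\sigma^v$; $F^{R*}$ if $\sigma^v<0<\sigma^+$; $F(\omega^R)$ if $\sigma^+<0$, where $F^{\alpha*}=(\rho^{\alpha*}v^*,\rho^{\alpha*}u^{\alpha*}v^*+\pi^{\alpha*}/M^2,(E^{\alpha*}+\pi^{\alpha*})v^* )$ (when $\sigma^\pm=0$ the adjacent formulas coincide). The numerical sources are $S^{+}=-(\mathrm{sgn}(v^* )+1)(0,\frac{\bar\rho}{M^2},\bar\rho v^* )^T$ and $S^{-}=(\mathrm{sgn}(v^* )-1)(0,\frac{\bar\rho}{M^2},\bar\rho v^* )^T$, with $\mathrm{sgn}(0)=1$. The update is $\omega_i^{n+1}=\omega_i^n-\frac{\Delta t}{\Delta x}(F_{i+1/2}^n-F_{i-1/2}^n)+\frac{\Delta t}{2}\big(S_{i-1/2}^{+,n}\frac{\Phi_i-\Phi_{i-1}}{\Delta x}+S_{i+1/2}^{-,n}\frac{\Phi_{i+1}-\Phi_i}{\Delta x}\big)$, where a subscript $i+1/2$ means evaluation at left state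 $(\omega_i^n,\Phi_i)$ and right state $(\omega_{i+1}^n,\Phi_{i+1})$. CFL condition: $\frac{\Delta t}{\Delta x}\max_i\{|v_i-\frac{a_i}{M\rho_i}|,|v_i+\frac{a_i}{M\rho_i}|\}\le\frac12$, where $v_i=u_i^n$, $\rho_i=\rho_i^n$ and $a_i$ runs over the speeds $a$ attached to cell $i$ at its two interfaces. The function $f_{I,J}$ is $f_{I,J}(\tau)=\tau\,p\big(\tau,J+\tfrac{(I-ab\tau)^2}{2ab}\big)+ab\tau^2-I\tau$ for $\tau\in\mathbb{R}^+$ (the pressure law being understood to be defined at these arguments, as for an ideal gas). *)

theory Defs
  imports "HOL-Analysis.Analysis"
begin

section \<open>Smoothness and strict convexity\<close>

text \<open>Meaningful for open \<open>S\<close>, since derivatives are two-sided.\<close>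

primrec Ck_on :: "nat \<Rightarrow> ('a::real_normed_vector \<Rightarrow> real) \<Rightarrow> 'a set \<Rightarrow> bool" where
  "Ck_on 0 f S \<longleftrightarrow> continuous_on S f"
| "Ck_on (Suc k) f S \<longleftrightarrow>
     (\<forall>x\<in>S. f differentiable (at x)) \<and>
     (\<forall>h. Ck_on k (\<lambda>x. frechet_derivative f (at x) h) S)"

definition smooth_on :: "('a::real_normed_vector \<Rightarrow> real) \<Rightarrow> 'a set \<Rightarrow> bool" where
  "smooth_on f S \<longleftrightarrow> (\<forall>k. Ck_on k f S)"

definition strictly_convex_on :: "'a::real_vector set \<Rightarrow> ('a \<Rightarrow> real) \<Rightarrow> bool" where
  "strictly_convex_on S f \<longleftrightarrow> convex S \<and>
     (\<forall>x\<in>S. \<forall>y\<in>S. x \<noteq> y \<longrightarrow>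
        (\<forall>u>0. \<forall>v>0. u + v = 1 \<longrightarrow> f (u *\<^sub>R x + v *\<^sub>R y) < u * f x + v * f y))"


section \<open>Thermodynamics\<close>

text \<open>The functions \<open>p\<close>, \<open>s\<close>, \<open>T\<close> take the pair \<open>(\<tau>, e)\<close> of specific volume and specific internal
  energy. They are total in HOL; only their values on the open quadrant are constrained here.\<close>

definition quadrant :: "(real \<times> real) set" where
  "quadrant = {0<..} \<times> {0<..}"

text \<open>The Gibbs relation \<open>- T ds = de + p d\<tau>\<close> is the last conjunct.\<close>

definition equation_of_state ::
    "(real \<times> real \<Rightarrow> real) \<Rightarrow> (real \<times> real \<Rightarrow> real) \<Rightarrow> (real \<times> real \<Rightarrow> real) \<Rightarrow> bool" where
  "equation_of_state p s T \<longleftrightarrow>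
     smooth_on p quadrant \<and>
     strictly_convex_on quadrant s \<and>
     (\<forall>z\<in>quadrant. s z > 0 \<and> T z > 0 \<and>
        (s has_derivative (\<lambda>(d\<tau>, de). - (de + p z * d\<tau>) / T z)) (at z))"

definition fIJ :: "(real \<times> real \<Rightarrow> real) \<Rightarrow> real \<Rightarrow> real \<Rightarrow> real \<Rightarrow> real \<Rightarrow> real \<Rightarrow> real" where
  "fIJ p a b I J \<tau> =
     \<tau> * p (\<tau>, J + (I - a * b * \<tau>)\<^sup>2 / (2 * a * b)) + a * b * \<tau>\<^sup>2 - I * \<tau>"


section \<open>The Euler equations\<close>

type_synonym euler_state = "real \<times> real \<times> real" \<comment> \<open>\<open>(\<rho>, \<rho> u, E)\<close>\<close>

definition mass_density :: "euler_state \<Rightarrow> real" where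
  "mass_density \<omega> = fst \<omega>"

definition momentum :: "euler_state \<Rightarrow> real" where
  "momentum \<omega> = fst (snd \<omega>)"

definition energy :: "euler_state \<Rightarrow> real" where
  "energy \<omega> = snd (snd \<omega>)"

definition velocity :: "euler_state \<Rightarrow> real" where
  "velocity \<omega> = momentum \<omega> / mass_density \<omega>"

definition specific_volume :: "euler_state \<Rightarrow> real" where
  "specific_volume \<omega> = 1 / mass_density \<omega>"

text \<open>This solves \<open>E = \<rho> e + M\<^sup>2 \<rho> u\<^sup>2 / 2\<close> for \<open>e\<close>.\<close>

definition internal_energy :: "real \<Rightarrow> euler_state \<Rightarrow> real" where
  "internal_energy M \<omega> = energy \<omega> / mass_density \<omega> - M\<^sup>2 * (velocity \<omega>)\<^sup>2 / 2"

definition phase_space :: "real \<Rightarrow> euler_state set" where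
  "phase_space M = {\<omega>. mass_density \<omega> > 0 \<and> internal_energy M \<omega> > 0}"

definition pressure :: "(real \<times> real \<Rightarrow> real) \<Rightarrow> real \<Rightarrow> euler_state \<Rightarrow> real" where
  "pressure p M \<omega> = p (specific_volume \<omega>, internal_energy M \<omega>)"

definition euler_flux :: "(real \<times> real \<Rightarrow> real) \<Rightarrow> real \<Rightarrow> euler_state \<Rightarrow> euler_state" where
  "euler_flux p M \<omega> =
     (momentum \<omega>,
      mass_density \<omega> * (velocity \<omega>)\<^sup>2 + pressure p M \<omega> / M\<^sup>2,
      (energy \<omega> + pressure p M \<omega>) * velocity \<omega>)"


section \<open>The approximate Riemann solver\<close>

text \<open>The state \<open>W = (\<rho>, \<rho> u, E, \<rho> \<pi>, \<rho> v, \<rho> Z, a, b)\<close>; the first three components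
  form \<open>euler_part\<close>.\<close>

record relax_state =
  euler_part :: euler_state
  rho_pi :: real
  rho_v :: real
  rho_Z :: real
  speed_a :: real
  speed_b :: real

definition relax_pressure :: "relax_state \<Rightarrow> real" where
  "relax_pressure W = rho_pi W / mass_density (euler_part W)"

definition relax_velocity :: "relax_state \<Rightarrow> real" where
  "relax_velocity W = rho_v W / mass_density (euler_part W)"

definition relax_potential :: "relax_state \<Rightarrow> real" where
  "relax_potential W = rho_Z W / mass_density (euler_part W)"

definition equilibrium ::
    "(real \<times> real \<Rightarrow> real) \<Rightarrow> real \<Rightarrow> euler_state \<Rightarrow> real \<Rightarrow> real \<Rightarrow> real \<Rightarrow> relax_state" where
  "equilibrium p M \<omega> \<phi> a b =
     \<lparr>euler_part = \<omega>,
      rho_pi = mass_density \<omega> * pressure p M \<omega>,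
      rho_v = mass_density \<omega> * velocity \<omega>,
      rho_Z = mass_density \<omega> * \<phi>,
      speed_a = a,
      speed_b = b\<rparr>"

type_synonym density_mean = "relax_state \<Rightarrow> relax_state \<Rightarrow> real"

definition density_average :: "density_mean \<Rightarrow> bool" where
  "density_average r \<longleftrightarrow>
     (\<forall>WL WR. \<forall>\<rho>>0. mass_density (euler_part WL) = \<rho> \<and> mass_density (euler_part WR) = \<rho> \<longrightarrow> r WL WR = \<rho>)"

definition Delta :: "density_mean \<Rightarrow> relax_state \<Rightarrow> relax_state \<Rightarrow> real" where
  "Delta r WL WR = r WL WR * (relax_potential WR - relax_potential WL)"

definition v_star :: "real \<Rightarrow> density_mean \<Rightarrow> relax_state \<Rightarrow> relax_state \<Rightarrow> real" where
  "v_star M r WL WR =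
     (M * speed_b WL * relax_velocity WL + M * speed_b WR * relax_velocity WR
        + relax_pressure WL - relax_pressure WR - Delta r WL WR)
     / (M * (speed_b WL + speed_b WR))"

definition tau_star_L :: "real \<Rightarrow> density_mean \<Rightarrow> relax_state \<Rightarrow> relax_state \<Rightarrow> real" where
  "tau_star_L M r WL WR =
     1 / mass_density (euler_part WL)
     + (M * speed_b WR * (relax_velocity WR - relax_velocity WL)
          + relax_pressure WL - relax_pressure WR - Delta r WL WR)
       / (speed_a WL * (speed_b WL + speed_b WR))"

definition tau_star_R :: "real \<Rightarrow> density_mean \<Rightarrow> relax_state \<Rightarrow> relax_state \<Rightarrow> real" where
  "tau_star_R M r WL WR =
     1 / mass_density (euler_part WR)
     + (M * speed_b WL * (relax_velocity WR - relax_velocity WL)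
          + relax_pressure WR - relax_pressure WL + Delta r WL WR)
       / (speed_a WR * (speed_b WL + speed_b WR))"

definition u_star_L :: "real \<Rightarrow> density_mean \<Rightarrow> relax_state \<Rightarrow> relax_state \<Rightarrow> real" where
  "u_star_L M r WL WR =
     velocity (euler_part WL)
     + speed_b WL * (M * speed_b WR * (relax_velocity WR - relax_velocity WL)
          + relax_pressure WL - relax_pressure WR - Delta r WL WR)
       / (M * speed_a WL * (speed_b WL + speed_b WR))"

definition u_star_R :: "real \<Rightarrow> density_mean \<Rightarrow> relax_state \<Rightarrow> relax_state \<Rightarrow> real" where
  "u_star_R M r WL WR =
     velocity (euler_part WR)
     + speed_b WR * (M * speed_b WL * (relax_velocity WL - relax_velocity WR)
          + relax_pressure WL - relax_pressure WR - Delta r WL WR)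
       / (M * speed_a WR * (speed_b WL + speed_b WR))"

definition pi_star_L :: "real \<Rightarrow> density_mean \<Rightarrow> relax_state \<Rightarrow> relax_state \<Rightarrow> real" where
  "pi_star_L M r WL WR =
     (speed_b WR * relax_pressure WL + speed_b WL * relax_pressure WR
        + M * speed_b WL * speed_b WR * (relax_velocity WL - relax_velocity WR)
        + speed_b WL * Delta r WL WR)
     / (speed_b WL + speed_b WR)"

definition pi_star_R :: "real \<Rightarrow> density_mean \<Rightarrow> relax_state \<Rightarrow> relax_state \<Rightarrow> real" where
  "pi_star_R M r WL WR =
     (speed_b WR * relax_pressure WL + speed_b WL * relax_pressure WR
        + M * speed_b WL * speed_b WR * (relax_velocity WL - relax_velocity WR)
        - speed_b WR * Delta r WL WR)
     / (speed_b WL + speed_b WR)"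

text \<open>The arguments \<open>\<pi>s\<close>, \<open>us\<close>, \<open>vs\<close> are the starred values on the side of \<open>W\<close>.\<close>

definition e_star :: "real \<Rightarrow> relax_state \<Rightarrow> real \<Rightarrow> real \<Rightarrow> real \<Rightarrow> real" where
  "e_star M W \<pi>s us vs =
     internal_energy M (euler_part W)
     + (\<pi>s\<^sup>2 - (relax_pressure W)\<^sup>2) / (2 * speed_a W * speed_b W)
     + (if speed_a W = speed_b W then 0
        else M\<^sup>2 * ((vs - us)\<^sup>2 - (relax_velocity W - velocity (euler_part W))\<^sup>2)
             / (2 * (speed_a W / speed_b W - 1)))"

text \<open>The intermediate state on the side of \<open>W\<close> with the given primitive values.\<close>

definition star_state ::
    "real \<Rightarrow> relax_state \<Rightarrow> real \<Rightarrow> real \<Rightarrow> real \<Rightarrow> real \<Rightarrow> real \<Rightarrow> relax_state" where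
  "star_state M W \<tau>s us es \<pi>s vs =
     (let \<rho>s = 1 / \<tau>s in
       \<lparr>euler_part = (\<rho>s, \<rho>s * us, \<rho>s * es + M\<^sup>2 * \<rho>s * us\<^sup>2 / 2),
        rho_pi = \<rho>s * \<pi>s,
        rho_v = \<rho>s * vs,
        rho_Z = \<rho>s * relax_potential W,
        speed_a = speed_a W,
        speed_b = speed_b W\<rparr>)"

definition W_star_L :: "real \<Rightarrow> density_mean \<Rightarrow> relax_state \<Rightarrow> relax_state \<Rightarrow> relax_state" where
  "W_star_L M r WL WR =
     star_state M WL (tau_star_L M r WL WR) (u_star_L M r WL WR)
       (e_star M WL (pi_star_L M r WL WR) (u_star_L M r WL WR) (v_star M r WL WR))
       (pi_star_L M r WL WR) (v_star M r WL WR)"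

definition W_star_R :: "real \<Rightarrow> density_mean \<Rightarrow> relax_state \<Rightarrow> relax_state \<Rightarrow> relax_state" where
  "W_star_R M r WL WR =
     star_state M WR (tau_star_R M r WL WR) (u_star_R M r WL WR)
       (e_star M WR (pi_star_R M r WL WR) (u_star_R M r WL WR) (v_star M r WL WR))
       (pi_star_R M r WL WR) (v_star M r WL WR)"

definition sigma_minus :: "real \<Rightarrow> relax_state \<Rightarrow> real" where
  "sigma_minus M WL = relax_velocity WL - speed_a WL / (M * mass_density (euler_part WL))"

definition sigma_plus :: "real \<Rightarrow> relax_state \<Rightarrow> real" where
  "sigma_plus M WR = relax_velocity WR + speed_a WR / (M * mass_density (euler_part WR))"

text \<open>\<open>a b > p \<partial>\<^sub>e p - \<partial>\<^sub>\<tau> p\<close> at the specific volume and internal energy of \<open>W\<close>, with the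
  speeds \<open>a\<close>, \<open>b\<close> carried by \<open>W\<close>.\<close>

definition subcharacteristic :: "(real \<times> real \<Rightarrow> real) \<Rightarrow> real \<Rightarrow> relax_state \<Rightarrow> bool" where
  "subcharacteristic p M W \<longleftrightarrow>
     (let \<tau> = specific_volume (euler_part W); e = internal_energy M (euler_part W) in
       speed_a W * speed_b W
         > p (\<tau>, e) * deriv (\<lambda>e'. p (\<tau>, e')) e - deriv (\<lambda>\<tau>'. p (\<tau>', e)) \<tau>)"


section \<open>The relaxation scheme\<close>

definition relax_flux :: "real \<Rightarrow> relax_state \<Rightarrow> euler_state" where
  "relax_flux M W =
     (let \<omega> = euler_part W; v = relax_velocity W; \<pi> = relax_pressure W in
       (mass_density \<omega> * v,
        mass_density \<omega> * velocity \<omega> * v + \<pi> / M\<^sup>2,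
        (energy \<omega> + \<pi>) * v))"

text \<open>For \<open>\<sigma>\<^sup>- = 0\<close> or \<open>\<sigma>\<^sup>+ = 0\<close> the two adjacent branches agree, so the choice made here is
  immaterial.\<close>

definition numerical_flux ::
    "(real \<times> real \<Rightarrow> real) \<Rightarrow> real \<Rightarrow> density_mean \<Rightarrow> relax_state \<Rightarrow> relax_state \<Rightarrow> euler_state" where
  "numerical_flux p M r WL WR =
     (if sigma_minus M WL > 0 then euler_flux p M (euler_part WL)
      else if v_star M r WL WR \<ge> 0 then relax_flux M (W_star_L M r WL WR)
      else if sigma_plus M WR > 0 then relax_flux M (W_star_R M r WL WR)
      else euler_flux p M (euler_part WR))"

text \<open>Unlike the library's \<open>sgn\<close>, this takes the value \<open>1\<close> at \<open>0\<close>.\<close>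

definition sgn1 :: "real \<Rightarrow> real" where
  "sgn1 x = (if x < 0 then - 1 else 1)"

definition source_plus :: "real \<Rightarrow> density_mean \<Rightarrow> relax_state \<Rightarrow> relax_state \<Rightarrow> euler_state" where
  "source_plus M r WL WR =
     (- (sgn1 (v_star M r WL WR) + 1)) *\<^sub>R (0, r WL WR / M\<^sup>2, r WL WR * v_star M r WL WR)"

definition source_minus :: "real \<Rightarrow> density_mean \<Rightarrow> relax_state \<Rightarrow> relax_state \<Rightarrow> euler_state" where
  "source_minus M r WL WR =
     (sgn1 (v_star M r WL WR) - 1) *\<^sub>R (0, r WL WR / M\<^sup>2, r WL WR * v_star M r WL WR)"

text \<open>Interfaces are indexed by the cell on their left: \<open>WL i\<close> and \<open>WR i\<close> are the left and right
  Riemann data at the interface \<open>i + 1/2\<close>.\<close>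

definition scheme_update ::
    "(real \<times> real \<Rightarrow> real) \<Rightarrow> real \<Rightarrow> density_mean \<Rightarrow> real \<Rightarrow> real \<Rightarrow> (int \<Rightarrow> real) \<Rightarrow> (int \<Rightarrow> euler_state)
      \<Rightarrow> (int \<Rightarrow> relax_state) \<Rightarrow> (int \<Rightarrow> relax_state) \<Rightarrow> int \<Rightarrow> euler_state" where
  "scheme_update p M r \<Delta>t \<Delta>x \<Phi> \<omega> WL WR i =
     \<omega> i
     - (\<Delta>t / \<Delta>x) *\<^sub>R (numerical_flux p M r (WL i) (WR i)
                     - numerical_flux p M r (WL (i - 1)) (WR (i - 1)))
     + (\<Delta>t / 2) *\<^sub>R (((\<Phi> i - \<Phi> (i - 1)) / \<Delta>x) *\<^sub>R source_plus M r (WL (i - 1)) (WR (i - 1))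
                   + ((\<Phi> (i + 1) - \<Phi> i) / \<Delta>x) *\<^sub>R source_minus M r (WL i) (WR i))"

text \<open>Cell \<open>i\<close> is on the left of the interface \<open>i + 1/2\<close> and on the right of \<open>i - 1/2\<close>, so the
  speeds \<open>a\<close> attached to it are \<open>aL i\<close> and \<open>aR (i - 1)\<close>.\<close>

definition CFL ::
    "real \<Rightarrow> real \<Rightarrow> real \<Rightarrow> (int \<Rightarrow> euler_state) \<Rightarrow> (int \<Rightarrow> real) \<Rightarrow> (int \<Rightarrow> real) \<Rightarrow> bool" where
  "CFL M \<Delta>t \<Delta>x \<omega> aL aR \<longleftrightarrow>
     (\<forall>i. \<forall>a\<in>{aL i, aR (i - 1)}.
        \<Delta>t / \<Delta>x * max \<bar>velocity (\<omega> i) - a / (M * mass_density (\<omega> i))\<bar>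
                     \<bar>velocity (\<omega> i) + a / (M * mass_density (\<omega> i))\<bar> \<le> 1 / 2)"

end

theory Submission
  imports Defs
begin

text \<open>
  The cell average at the new time is the mean of two half-cell averages of the approximate Riemann
  solver: the states of the left interface in \<open>x > 0\<close> and those of the right interface in \<open>x < 0\<close>.
  Indeed the solver satisfies the Rankine--Hugoniot relations of the Euler variables across
  \<open>\<sigma>\<^sup>-\<close> and \<open>\<sigma>\<^sup>+\<close>, and across \<open>\<sigma>\<^sup>v\<close> up to exactly the source term that the scheme
  hands to the cell on the downwind side of \<open>v\<^sup>*\<close>. Under the CFL condition the new state is thus a
  convex combination of states in \<open>\<Omega>\<close>, and \<open>\<Omega>\<close> is convex because \<open>\<rho> e\<close> is a concave function
  of \<open>(\<rho>, \<rho> u, E)\<close>.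
\<close>

section \<open>Convexity of the phase space\<close>

text \<open>Multiplying \<open>e > 0\<close> by the positive density gives a strict epigraph
  condition, the form in which convexity can be checked.\<close>

lemma mem_phase_space_iff:
  "(\<rho>, m, E) \<in> phase_space M \<longleftrightarrow> \<rho> > 0 \<and> E > M\<^sup>2 * m\<^sup>2 / (2 * \<rho>)"
  by (auto simp: phase_space_def internal_energy_def velocity_def mass_density_def momentum_def
      energy_def field_simps power2_eq_square)

text \<open>This is subadditivity of the perspective of the square; the defect is itself a square
  over a positive denominator.\<close>

lemma square_over_linear_add:
  fixes r s m n :: real
  assumes "r > 0" "s > 0"
  shows "(m + n)\<^sup>2 / (r + s) \<le> m\<^sup>2 / r + n\<^sup>2 / s"
proof -
  have "m\<^sup>2 / r + n\<^sup>2 / s - (m + n)\<^sup>2 / (r + s) = (s * m - r * n)\<^sup>2 / (r * s * (r + s))"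
    using assms add_pos_pos[OF assms]
    by (simp add: divide_simps) (simp add: algebra_simps power2_eq_square)
  also have "\<dots> \<ge> 0"
    using assms by simp
  finally show ?thesis
    by simp
qed

text \<open>The epigraph condition is homogeneous of degree one, so the phase space is a cone and
  its convexity splits into closure under sums and under positive scaling.\<close>

lemma phase_space_add:
  assumes "x \<in> phase_space M" "y \<in> phase_space M"
  shows "x + y \<in> phase_space M"
proof -
  obtain r m E s n D where xy: "x = (r, m, E)" "y = (s, n, D)"
    by (metis prod_cases3)
  with assms have pos: "r > 0" "s > 0"
    and E: "E > M\<^sup>2 * m\<^sup>2 / (2 * r)" and D: "D > M\<^sup>2 * n\<^sup>2 / (2 * s)"
    by (simp_all add: mem_phase_space_iff)
  have "M\<^sup>2 / 2 * ((m + n)\<^sup>2 / (r + s)) \<le> M\<^sup>2 / 2 * (m\<^sup>2 / r + n\<^sup>2 / s)"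
    by (intro mult_left_mono square_over_linear_add pos) simp
  with E D have "E + D > M\<^sup>2 * (m + n)\<^sup>2 / (2 * (r + s))"
    by (simp add: algebra_simps)
  with pos show ?thesis
    by (simp add: xy mem_phase_space_iff)
qed

lemma phase_space_scaleR:
  assumes "x \<in> phase_space M" "c > 0"
  shows "c *\<^sub>R x \<in> phase_space M"
proof -
  obtain r m E where x: "x = (r, m, E)"
    by (metis prod_cases3)
  have "M\<^sup>2 * (c * m)\<^sup>2 / (2 * (c * r)) = c * (M\<^sup>2 * m\<^sup>2 / (2 * r))"
    using assms(2) by (simp add: power2_eq_square)
  also have "\<dots> < c * E"
    using assms by (intro mult_strict_left_mono) (simp_all add: x mem_phase_space_iff)
  finally show ?thesis
    using assms by (simp add: x mem_phase_space_iff)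
qed

lemma convex_phase_space: "convex (phase_space M)"
  unfolding convex_alt
proof (intro ballI allI impI)
  fix x y and c :: real
  assume xy: "x \<in> phase_space M" "y \<in> phase_space M" and c: "0 \<le> c \<and> c \<le> 1"
  \<comment> \<open>The cone does not contain zero, so a vanishing coefficient cannot be handled by
    scaling.\<close>
  consider "c = 0" | "c = 1" | "c > 0" "1 - c > 0"
    using c by fastforce
  then show "(1 - c) *\<^sub>R x + c *\<^sub>R y \<in> phase_space M"
    by cases (simp_all add: phase_space_add phase_space_scaleR xy)
qed

text \<open>The decreasing coefficients are those of an Abel summation of a convex combination; in this
  form they are the truncated wave speeds.\<close>

lemma convex_telescoping_combination:
  fixes x0 x1 x2 x3 :: "'a::real_vector"
  assumes "convex K" "x0 \<in> K" "x1 \<in> K" "x2 \<in> K" "x3 \<in> K"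
    and "1 \<ge> c1" "c1 \<ge> c2" "c2 \<ge> c3" "c3 \<ge> 0"
  shows "x0 + c1 *\<^sub>R (x1 - x0) + c2 *\<^sub>R (x2 - x1) + c3 *\<^sub>R (x3 - x2) \<in> K"
proof -
  define c where "c = (!) [1 - c1, c1 - c2, c2 - c3, c3]"
  define x where "x = (!) [x0, x1, x2, x3]"
  have "(\<Sum>j<4. c j *\<^sub>R x j) \<in> K"
    using assms by (intro convex_sum) (auto simp: c_def x_def eval_nat_numeral less_Suc_eq)
  then show ?thesis
    by (simp add: c_def x_def eval_nat_numeral algebra_simps)
qed

section \<open>Abstract three-wave fans and their half-cell averages\<close>

text \<open>\<open>S\<close> is the defect of the Rankine-Hugoniot relation at the middle wave,
  where gravity acts. Both outer relations go from an outer state to its starred neighbour, so that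
  one computation serves both sides.\<close>

locale wave_fan =
  fixes K :: "'a::real_vector set"
    and wL wL' wR' wR fL fL' fR' fR S :: 'a
    and s1 s2 s3 :: real
  assumes convex: "convex K"
    and states: "wL \<in> K" "wL' \<in> K" "wR' \<in> K" "wR \<in> K"
    and jump1: "fL' - fL = s1 *\<^sub>R (wL' - wL)"
    and jump2: "fR' - fL' = s2 *\<^sub>R (wR' - wL') - S"
    and jump3: "fR' - fR = s3 *\<^sub>R (wR' - wR)"
    and speeds: "s1 < s2" "s2 < s3"
begin

text \<open>This is the flux at \<open>x = 0\<close>. The choice of \<open>fL'\<close> at
  \<open>s2 = 0\<close> matches \<open>sgn1 0 = 1\<close>: a stationary middle wave gives its source
  to the right cell.\<close>

definition flux :: 'a where
  "flux = (if s1 > 0 then fL else if s2 \<ge> 0 then fL' else if s3 > 0 then fR' else fR)"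

text \<open>Only waves of negative speed lie between the left state and \<open>x = 0\<close>. Adding
  their jump relations gives the flux difference, and truncating the speeds merges the four branches
  into one identity.\<close>

lemma flux_left:
  "fL - flux - (if s2 < 0 then S else 0) =
     max (- s1) 0 *\<^sub>R (wL' - wL) + max (- s2) 0 *\<^sub>R (wR' - wL') + max (- s3) 0 *\<^sub>R (wR - wR')"
proof -
  have f: "fL' = fL + s1 *\<^sub>R (wL' - wL)" "fR' = fL' + s2 *\<^sub>R (wR' - wL') - S"
    "fR = fR' - s3 *\<^sub>R (wR' - wR)"
    using jump1 jump2 jump3 by (simp_all add: algebra_simps)
  show ?thesis
    unfolding flux_def unfolding f using speeds by (auto simp: max_def scaleR_diff_right)
qed

lemma flux_right:
  "flux - fR - (if s2 < 0 then 0 else S) =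
     max s3 0 *\<^sub>R (wR' - wR) + max s2 0 *\<^sub>R (wL' - wR') + max s1 0 *\<^sub>R (wL - wL')"
proof -
  have f: "fR' = fR + s3 *\<^sub>R (wR' - wR)" "fL' = fR' - s2 *\<^sub>R (wR' - wL') + S"
    "fL = fL' - s1 *\<^sub>R (wL' - wL)"
    using jump1 jump2 jump3 by (simp_all add: algebra_simps)
  show ?thesis
    unfolding flux_def unfolding f using speeds by (auto simp: max_def scaleR_diff_right)
qed

text \<open>For unit time and half-cell width \<open>1/c\<close>, this is the average of the fan
  over the left half-cell. The truncated speeds decrease along the fan, so a bound on the leftmost
  one controls all coefficients.\<close>

lemma left_half_average:
  assumes "c \<ge> 0" "c * \<bar>s1\<bar> \<le> 1"
  shows "wL + c *\<^sub>R (fL - flux - (if s2 < 0 then S else 0)) \<in> K"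
proof -
  have "c * max (- s1) 0 \<le> c * \<bar>s1\<bar>"
    using assms by (intro mult_left_mono) auto
  with assms have "wL + (c * max (- s1) 0) *\<^sub>R (wL' - wL) + (c * max (- s2) 0) *\<^sub>R (wR' - wL')
      + (c * max (- s3) 0) *\<^sub>R (wR - wR') \<in> K"
    using speeds by (intro convex_telescoping_combination convex states mult_left_mono) auto
  then show ?thesis
    by (simp add: flux_left scaleR_add_right add.assoc)
qed

lemma right_half_average:
  assumes "c \<ge> 0" "c * \<bar>s3\<bar> \<le> 1"
  shows "wR + c *\<^sub>R (flux - fR - (if s2 < 0 then 0 else S)) \<in> K"
proof -
  have "c * max s3 0 \<le> c * \<bar>s3\<bar>"
    using assms by (intro mult_left_mono) auto
  with assms have "wR + (c * max s3 0) *\<^sub>R (wR' - wR) + (c * max s2 0) *\<^sub>R (wL' - wR')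
      + (c * max s1 0) *\<^sub>R (wL - wL') \<in> K"
    using speeds by (intro convex_telescoping_combination convex states mult_left_mono) auto
  then show ?thesis
    by (simp add: flux_right scaleR_add_right add.assoc)
qed

end

section \<open>Jump relations across the outer waves\<close>

text \<open>Both outer waves at once: \<open>\<epsilon> = 1\<close> for \<open>\<sigma>\<^sup>+\<close> and \<open>\<epsilon> = - 1\<close> for \<open>\<sigma>\<^sup>-\<close>; \<open>X\<close> is the jump
  \<open>v\<^sup>* - v\<close>.\<close>

lemma star_state_jump:
  fixes \<epsilon> X :: real
  assumes M: "M > 0" and ab: "b \<le> a" "b > 0" and \<rho>: "mass_density \<omega> > 0"
    and \<epsilon>: "\<bar>\<epsilon>\<bar> = 1"
    and W: "W = equilibrium p M \<omega> \<phi> a b"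
    and \<tau>s: "\<tau>s = 1 / mass_density \<omega> - \<epsilon> * M * X / a" "\<tau>s > 0"
    and us: "us = velocity \<omega> + b * X / a"
    and \<pi>s: "\<pi>s = pressure p M \<omega> + \<epsilon> * M * b * X"
    and vs: "vs = velocity \<omega> + X"
    and \<sigma>: "\<sigma> = velocity \<omega> + \<epsilon> * a / (M * mass_density \<omega>)"
  defines "W' \<equiv> star_state M W \<tau>s us (e_star M W \<pi>s us vs) \<pi>s vs"
  shows "relax_flux M W' - euler_flux p M \<omega> = \<sigma> *\<^sub>R (euler_part W' - \<omega>)"
    and "relax_flux M W' = vs *\<^sub>R euler_part W' + (0, \<pi>s / M\<^sup>2, \<pi>s * vs)"
proof -
  define \<rho>0 u E \<pi> e where defs: "\<rho>0 = mass_density \<omega>" "u = velocity \<omega>" "E = energy \<omega>"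
    "\<pi> = pressure p M \<omega>" "e = internal_energy M \<omega>"
  have \<rho>0: "\<rho>0 > 0"
    using \<rho> by (simp add: defs)
  have \<omega>: "\<omega> = (\<rho>0, \<rho>0 * u, \<rho>0 * e + M\<^sup>2 * \<rho>0 * u\<^sup>2 / 2)"
    using \<rho> by (cases \<omega>) (auto simp: defs mass_density_def velocity_def momentum_def energy_def
        internal_energy_def field_simps)
  have \<epsilon>2: "\<epsilon> * \<epsilon> = 1"
    using \<epsilon> by (metis abs_mult_self_eq mult_1)
  define es where "es = e_star M W \<pi>s us vs"
  have part: "euler_part W' = (1 / \<tau>s, us / \<tau>s, es / \<tau>s + M\<^sup>2 * us\<^sup>2 / \<tau>s / 2)"
    by (simp add: W'_def star_state_def Let_def es_def)
  have flux: "relax_flux M W' =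
      (vs / \<tau>s, us * vs / \<tau>s + \<pi>s / M\<^sup>2, (es / \<tau>s + M\<^sup>2 * us\<^sup>2 / \<tau>s / 2 + \<pi>s) * vs)"
    using \<tau>s(2) unfolding W'_def es_def
    by (simp add: star_state_def Let_def relax_flux_def relax_velocity_def
        relax_pressure_def mass_density_def energy_def velocity_def momentum_def)
  show "relax_flux M W' = vs *\<^sub>R euler_part W' + (0, \<pi>s / M\<^sup>2, \<pi>s * vs)"
    by (simp add: flux part algebra_simps)
  \<comment> \<open>The last term is \<open>- M^2 (us - u)^2 / 2\<close>; it will cancel the
    quadratic part of the kinetic energy jump.\<close>
  have es: "es = e + (\<epsilon> * M * \<pi> * X + M\<^sup>2 * b * X\<^sup>2) / a - M\<^sup>2 * b\<^sup>2 * X\<^sup>2 / (2 * a\<^sup>2)"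
  proof -
    have W_vals: "relax_velocity W = u" "relax_pressure W = \<pi>" "euler_part W = \<omega>"
      "speed_a W = a" "speed_b W = b"
      using \<rho> by (simp_all add: W equilibrium_def relax_velocity_def relax_pressure_def defs)
    have e0: "es = e + (\<pi>s\<^sup>2 - \<pi>\<^sup>2) / (2 * a * b)
        + (if a = b then 0 else M\<^sup>2 * ((vs - us)\<^sup>2 - (u - u)\<^sup>2) / (2 * (a / b - 1)))"
      by (simp add: es_def e_star_def W_vals defs)
    \<comment> \<open>The singularity at \<open>a = b\<close> is removable: \<open>vs - us\<close>
      carries the factor \<open>1 - b / a\<close>, whose square beats the denominator. The surviving
      factor vanishes at \<open>a = b\<close>, in agreement with the default value.\<close>
    have e1: "(if a = b then 0 else M\<^sup>2 * ((vs - us)\<^sup>2 - (u - u)\<^sup>2) / (2 * (a / b - 1)))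
        = M\<^sup>2 * X\<^sup>2 * (1 - b / a) * b / (2 * a)"
    proof (cases "a = b")
      case True
      then show ?thesis
        using ab by simp
    next
      case False
      have d: "vs - us = X * (1 - b / a)"
        using ab by (simp add: vs us algebra_simps)
      have "(1 - b / a) * (a / b) = a / b - 1"
        using ab by (simp add: field_simps)
      then have "M\<^sup>2 * (X * (1 - b / a))\<^sup>2 / (2 * (a / b - 1))
          = M\<^sup>2 * X\<^sup>2 * (1 - b / a)\<^sup>2 / (2 * ((1 - b / a) * (a / b)))"
        by (simp add: power_mult_distrib)
      also have "\<dots> = M\<^sup>2 * X\<^sup>2 * (1 - b / a) * b / (2 * a)"
        using False ab by (simp add: power2_eq_square)
      finally show ?thesis
        using False by (simp add: d)
    qed
    have e2: "(\<pi>s\<^sup>2 - \<pi>\<^sup>2) / (2 * a * b) = \<epsilon> * M * \<pi> * X / a + M\<^sup>2 * b * X\<^sup>2 / (2 * a)"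
    proof -
      have "\<pi>s\<^sup>2 - \<pi>\<^sup>2 = 2 * \<epsilon> * M * b * X * \<pi> + (\<epsilon> * \<epsilon>) * M\<^sup>2 * b\<^sup>2 * X\<^sup>2"
        by (simp add: \<pi>s defs power2_eq_square algebra_simps)
      then show ?thesis
        using ab by (simp add: \<epsilon>2 field_simps power2_eq_square)
    qed
    show ?thesis
      unfolding e0 e1 e2 using ab by (simp add: field_simps power2_eq_square)
  qed
  \<comment> \<open>This is the mass flux through the moving wave, seen from either side. Once it is
    known to be common, momentum and energy reduce to jumps per unit mass.\<close>
  have mass: "(\<sigma> - vs) / \<tau>s = \<epsilon> * a / M" "\<rho>0 * (\<sigma> - u) = \<epsilon> * a / M"
  proof -
    have "\<sigma> - vs = \<epsilon> * a / M * \<tau>s"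
    proof -
      have "\<epsilon> * a / M * \<tau>s = \<epsilon> * a / (M * \<rho>0) - \<epsilon> * \<epsilon> * X"
        using M ab by (simp add: \<tau>s(1) defs right_diff_distrib)
      then show ?thesis
        by (simp add: \<sigma> vs defs \<epsilon>2)
    qed
    then show "(\<sigma> - vs) / \<tau>s = \<epsilon> * a / M"
      using \<tau>s(2) by simp
    show "\<rho>0 * (\<sigma> - u) = \<epsilon> * a / M"
      using \<rho>0 by (simp add: \<sigma> defs)
  qed
  have c1: "vs / \<tau>s - \<rho>0 * u = \<sigma> * (1 / \<tau>s - \<rho>0)"
    using mass by (simp add: algebra_simps diff_divide_distrib)
  have c2: "us * vs / \<tau>s + \<pi>s / M\<^sup>2 - (\<rho>0 * u\<^sup>2 + \<pi> / M\<^sup>2) = \<sigma> * (us / \<tau>s - \<rho>0 * u)"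
  proof -
    \<comment> \<open>In the frame of the wave, the pressure jump balances the mass flux times the
      jump of \<open>u\<close>.\<close>
    have "us * vs / \<tau>s + \<pi>s / M\<^sup>2 - (\<rho>0 * u\<^sup>2 + \<pi> / M\<^sup>2) - \<sigma> * (us / \<tau>s - \<rho>0 * u)
        = (\<pi>s - \<pi>) / M\<^sup>2 - us * ((\<sigma> - vs) / \<tau>s) + u * (\<rho>0 * (\<sigma> - u))"
      by (simp add: algebra_simps diff_divide_distrib power2_eq_square)
    also have "\<dots> = 0"
      unfolding mass using M ab by (simp add: us \<pi>s defs field_simps power2_eq_square)
    finally show ?thesis
      by simp
  qed
  have c3: "(es / \<tau>s + M\<^sup>2 * us\<^sup>2 / \<tau>s / 2 + \<pi>s) * vs - (\<rho>0 * e + M\<^sup>2 * \<rho>0 * u\<^sup>2 / 2 + \<pi>) * u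
      = \<sigma> * (es / \<tau>s + M\<^sup>2 * us\<^sup>2 / \<tau>s / 2 - (\<rho>0 * e + M\<^sup>2 * \<rho>0 * u\<^sup>2 / 2))"
  proof -
    \<comment> \<open>Likewise, the jump of pressure work balances the mass flux times the jump of
      specific total energy.\<close>
    have "(es / \<tau>s + M\<^sup>2 * us\<^sup>2 / \<tau>s / 2 + \<pi>s) * vs - (\<rho>0 * e + M\<^sup>2 * \<rho>0 * u\<^sup>2 / 2 + \<pi>) * u
        - \<sigma> * (es / \<tau>s + M\<^sup>2 * us\<^sup>2 / \<tau>s / 2 - (\<rho>0 * e + M\<^sup>2 * \<rho>0 * u\<^sup>2 / 2))
        = \<pi>s * vs - \<pi> * u - (es + M\<^sup>2 * us\<^sup>2 / 2) * ((\<sigma> - vs) / \<tau>s)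
          + (e + M\<^sup>2 * u\<^sup>2 / 2) * (\<rho>0 * (\<sigma> - u))"
      by (simp add: algebra_simps diff_divide_distrib add_divide_distrib)
    also have "\<dots> = \<pi>s * vs - \<pi> * u
        - \<epsilon> * a / M * (es - e + M\<^sup>2 * us\<^sup>2 / 2 - M\<^sup>2 * u\<^sup>2 / 2)"
      unfolding mass by (simp add: algebra_simps)
    also have "es - e + M\<^sup>2 * us\<^sup>2 / 2 - M\<^sup>2 * u\<^sup>2 / 2
        = M / a * (\<epsilon> * \<pi> * X + M * b * X\<^sup>2 + M * b * u * X)"
      using ab by (simp add: es us defs power2_eq_square field_simps)
    also have "\<epsilon> * a / M * (M / a * (\<epsilon> * \<pi> * X + M * b * X\<^sup>2 + M * b * u * X))
        = (\<epsilon> * \<epsilon>) * \<pi> * X + \<epsilon> * M * b * X\<^sup>2 + \<epsilon> * M * b * u * X"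
      using M ab by (simp add: field_simps)
    also have "\<pi>s * vs - \<pi> * u - \<dots> = 0"
      by (simp add: \<epsilon>2 \<pi>s vs defs algebra_simps power2_eq_square)
    finally show ?thesis
      by simp
  qed
  have "euler_flux p M \<omega> = (\<rho>0 * u, \<rho>0 * u\<^sup>2 + \<pi> / M\<^sup>2, (\<rho>0 * e + M\<^sup>2 * \<rho>0 * u\<^sup>2 / 2 + \<pi>) * u)"
  proof -
    have "momentum \<omega> = \<rho>0 * u" "energy \<omega> = \<rho>0 * e + M\<^sup>2 * \<rho>0 * u\<^sup>2 / 2"
      using \<omega> by (simp_all add: momentum_def energy_def)
    then show ?thesis
      by (simp add: euler_flux_def defs)
  qed
  moreover have "\<sigma> *\<^sub>R (euler_part W' - \<omega>)
      = \<sigma> *\<^sub>R (euler_part W' - (\<rho>0, \<rho>0 * u, \<rho>0 * e + M\<^sup>2 * \<rho>0 * u\<^sup>2 / 2))"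
    using \<omega> by simp
  ultimately show "relax_flux M W' - euler_flux p M \<omega> = \<sigma> *\<^sub>R (euler_part W' - \<omega>)"
    using c1 c2 c3 by (simp add: part flux)
qed

section \<open>The Riemann solver at one interface as a wave fan\<close>

locale riemann_problem =
  fixes M :: real and p :: "real \<times> real \<Rightarrow> real" and r :: density_mean
    and wL wR :: euler_state and \<phi>L \<phi>R aL bL aR bR :: real and WL WR :: relax_state
  assumes M: "M > 0"
    and aL: "bL \<le> aL" "bL > 0" and aR: "bR \<le> aR" "bR > 0"
    and WL: "WL = equilibrium p M wL \<phi>L aL bL"
    and WR: "WR = equilibrium p M wR \<phi>R aR bR"
    and wL: "wL \<in> phase_space M" and wR: "wR \<in> phase_space M"
    and star_L: "euler_part (W_star_L M r WL WR) \<in> phase_space M"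
    and star_R: "euler_part (W_star_R M r WL WR) \<in> phase_space M"
begin

abbreviation source :: euler_state where
  "source \<equiv> Delta r WL WR *\<^sub>R (0, 1 / M\<^sup>2, v_star M r WL WR)"

lemma equilibrium_values:
  "relax_velocity WL = velocity wL" "relax_velocity WR = velocity wR"
  "relax_pressure WL = pressure p M wL" "relax_pressure WR = pressure p M wR"
  "euler_part WL = wL" "euler_part WR = wR"
  "speed_a WL = aL" "speed_b WL = bL" "speed_a WR = aR" "speed_b WR = bR"
  "Delta r WL WR = r WL WR * (\<phi>R - \<phi>L)"
  using wL wR
  by (simp_all add: WL WR equilibrium_def relax_velocity_def relax_pressure_def
      relax_potential_def Delta_def phase_space_def)

lemma tau_star_pos: "tau_star_L M r WL WR > 0" "tau_star_R M r WL WR > 0"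
  using star_L star_R
  by (simp_all add: phase_space_def W_star_L_def W_star_R_def star_state_def Let_def mass_density_def)

text \<open>All starred values are affine in the single velocity jump \<open>X\<close>. The factor
  \<open>- 1\<close> stays visible as the \<epsilon> of \<open>star_state_jump\<close>.\<close>

lemma star_values_L:
  defines "X \<equiv> v_star M r WL WR - velocity wL"
  shows "tau_star_L M r WL WR = 1 / mass_density wL - (- 1) * M * X / aL"
    and "u_star_L M r WL WR = velocity wL + bL * X / aL"
    and "pi_star_L M r WL WR = pressure p M wL + (- 1) * M * bL * X"
proof -
  \<comment> \<open>\<open>N\<close> is the numerator shared by the formulas for density and
    velocity; it equals \<open>X\<close> times \<open>M * (bL + bR)\<close>.\<close>
  define N where "N = M * bR * (velocity wR - velocity wL) + pressure p M wL - pressure p M wR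
    - Delta r WL WR"
  have b: "bL + bR > 0"
    using aL aR by simp
  have X: "X = N / (M * (bL + bR))"
  proof -
    have "v_star M r WL WR = (N + velocity wL * (M * (bL + bR))) / (M * (bL + bR))"
      by (simp add: v_star_def equilibrium_values(1-10) N_def algebra_simps)
    then show ?thesis
      using M b by (simp add: X_def add_divide_distrib)
  qed
  show "tau_star_L M r WL WR = 1 / mass_density wL - (- 1) * M * X / aL"
    using M b unfolding X by (simp add: tau_star_L_def equilibrium_values(1-10) N_def mult.commute)
  show "u_star_L M r WL WR = velocity wL + bL * X / aL"
    unfolding X by (simp add: u_star_L_def equilibrium_values(1-10) N_def mult_ac)
  show "pi_star_L M r WL WR = pressure p M wL + (- 1) * M * bL * X"
  proof -
    have "pi_star_L M r WL WR = (pressure p M wL * (bL + bR) - bL * N) / (bL + bR)"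
      by (simp add: pi_star_L_def equilibrium_values(1-10) N_def algebra_simps)
    then show ?thesis
      using M b by (simp add: X diff_divide_distrib add_divide_distrib)
  qed
qed

lemma star_values_R:
  defines "X \<equiv> v_star M r WL WR - velocity wR"
  shows "tau_star_R M r WL WR = 1 / mass_density wR - 1 * M * X / aR"
    and "u_star_R M r WL WR = velocity wR + bR * X / aR"
    and "pi_star_R M r WL WR = pressure p M wR + 1 * M * bR * X"
proof -
  define N where "N = M * bL * (velocity wL - velocity wR) + pressure p M wL - pressure p M wR
    - Delta r WL WR"
  have b: "bL + bR > 0"
    using aL aR by simp
  have X: "X = N / (M * (bL + bR))"
  proof -
    have "v_star M r WL WR = (N + velocity wR * (M * (bL + bR))) / (M * (bL + bR))"
      by (simp add: v_star_def equilibrium_values(1-10) N_def algebra_simps)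
    then show ?thesis
      using M b by (simp add: X_def add_divide_distrib)
  qed
  \<comment> \<open>On the right, the specific volume formula has the opposite sign convention,
    whence \<epsilon> = 1.\<close>
  have N: "M * bL * (velocity wR - velocity wL) + pressure p M wR - pressure p M wL
    + Delta r WL WR = - N"
    by (simp add: N_def algebra_simps)
  show "tau_star_R M r WL WR = 1 / mass_density wR - 1 * M * X / aR"
    using M b unfolding X by (simp add: tau_star_R_def equilibrium_values(1-10) N mult.commute)
  show "u_star_R M r WL WR = velocity wR + bR * X / aR"
    unfolding X by (simp add: u_star_R_def equilibrium_values(1-10) N_def mult_ac)
  show "pi_star_R M r WL WR = pressure p M wR + 1 * M * bR * X"
  proof -
    have "pi_star_R M r WL WR = (pressure p M wR * (bL + bR) + bR * N) / (bL + bR)"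
      by (simp add: pi_star_R_def equilibrium_values(1-10) N_def algebra_simps)
    then show ?thesis
      using M b by (simp add: X diff_divide_distrib add_divide_distrib)
  qed
qed

lemma sigma_eq:
  "sigma_minus M WL = velocity wL + (- 1) * aL / (M * mass_density wL)"
  "sigma_plus M WR = velocity wR + 1 * aR / (M * mass_density wR)"
  by (simp_all add: sigma_minus_def sigma_plus_def equilibrium_values(1-10))

lemma densities_pos: "mass_density wL > 0" "mass_density wR > 0"
  using wL wR by (simp_all add: phase_space_def)

text \<open>The two holes, the modulus of \<epsilon> and \<open>vs\<close> as velocity plus jump,
  are closed by simplification.\<close>

lemmas jump_L = star_state_jump[OF M aL densities_pos(1) _ WL star_values_L(1) tau_star_pos(1)
    star_values_L(2,3) _ sigma_eq(1), of "v_star M r WL WR", folded W_star_L_def, simplified]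

lemmas jump_R = star_state_jump[OF M aR densities_pos(2) _ WR star_values_R(1) tau_star_pos(2)
    star_values_R(2,3) _ sigma_eq(2), of "v_star M r WL WR", folded W_star_R_def, simplified]

lemma pi_star_jump: "pi_star_R M r WL WR - pi_star_L M r WL WR = - Delta r WL WR"
proof -
  have "bL + bR > 0"
    using aL aR by simp
  moreover have "pi_star_R M r WL WR - pi_star_L M r WL WR
      = (- Delta r WL WR * (bL + bR)) / (bL + bR)"
    unfolding pi_star_L_def pi_star_R_def equilibrium_values(1-10) diff_divide_distrib[symmetric]
    by (simp add: algebra_simps)
  ultimately show ?thesis
    by simp
qed

text \<open>Both starred states move with the same velocity, so after advection only the pressure
  jump \<open>- Delta\<close> remains in the flux difference.\<close>

lemma contact_jump:
  "relax_flux M (W_star_R M r WL WR) - relax_flux M (W_star_L M r WL WR)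
     = v_star M r WL WR *\<^sub>R (euler_part (W_star_R M r WL WR) - euler_part (W_star_L M r WL WR))
       - source"
proof -
  have \<pi>: "pi_star_R M r WL WR = pi_star_L M r WL WR - Delta r WL WR"
    using pi_star_jump by simp
  show ?thesis
    unfolding jump_L(2) jump_R(2) \<pi>
    by (simp add: scaleR_diff_right prod_eq_iff diff_divide_distrib left_diff_distrib)
qed

text \<open>The gap between an outer wave and the contact is \<open>a / M\<close> times the starred
  specific volume, so positive starred densities order the waves.\<close>

lemma wave_ordering:
  "sigma_minus M WL < v_star M r WL WR" "v_star M r WL WR < sigma_plus M WR"
proof -
  have "aL > 0" "aR > 0"
    using aL aR by simp_all
  then have "v_star M r WL WR - sigma_minus M WL = aL / M * tau_star_L M r WL WR"
    "sigma_plus M WR - v_star M r WL WR = aR / M * tau_star_R M r WL WR"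
    unfolding star_values_L star_values_R sigma_eq using M densities_pos
    by (simp_all add: field_simps)
  moreover have "aL / M * tau_star_L M r WL WR > 0" "aR / M * tau_star_R M r WL WR > 0"
    using M tau_star_pos \<open>aL > 0\<close> \<open>aR > 0\<close> by simp_all
  ultimately show "sigma_minus M WL < v_star M r WL WR" "v_star M r WL WR < sigma_plus M WR"
    by linarith+
qed

sublocale wave_fan "phase_space M" wL "euler_part (W_star_L M r WL WR)"
  "euler_part (W_star_R M r WL WR)" wR "euler_flux p M wL" "relax_flux M (W_star_L M r WL WR)"
  "relax_flux M (W_star_R M r WL WR)" "euler_flux p M wR" source
  "sigma_minus M WL" "v_star M r WL WR" "sigma_plus M WR"
  by unfold_locales
    (fact convex_phase_space wL wR star_L star_R jump_L(1) jump_R(1) contact_jump wave_ordering)+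

lemma numerical_flux_eq: "numerical_flux p M r WL WR = flux"
  by (simp add: numerical_flux_def flux_def equilibrium_values(1-10))

text \<open>The sign factor is \<open>- 2\<close> or \<open>0\<close>: the left cell receives the
  source only if the contact moves left. The 2 is absorbed by the factor
  \<open>\<Delta>t / 2\<close> of the scheme.\<close>

lemma source_minus_eq:
  "(\<phi>R - \<phi>L) *\<^sub>R source_minus M r WL WR
     = - 2 *\<^sub>R (if v_star M r WL WR < 0 then source else 0)"
  by (simp add: source_minus_def sgn1_def equilibrium_values(11) zero_prod_def)

lemma source_plus_eq:
  "(\<phi>R - \<phi>L) *\<^sub>R source_plus M r WL WR
     = - 2 *\<^sub>R (if v_star M r WL WR < 0 then 0 else source)"
  by (simp add: source_plus_def sgn1_def equilibrium_values(11) zero_prod_def)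

end

section \<open>Reassembly of the scheme from half-cell averages\<close>

theorem lemma8:
  fixes M \<Delta>t \<Delta>x :: real
    and p s T :: "real \<times> real \<Rightarrow> real"
    and rhobar :: "relax_state \<Rightarrow> relax_state \<Rightarrow> real"
    and \<Phi> :: "int \<Rightarrow> real"
    and aL aR bL bR :: "nat \<Rightarrow> int \<Rightarrow> real"
    and \<omega> :: "nat \<Rightarrow> int \<Rightarrow> euler_state"
    and WL WR :: "nat \<Rightarrow> int \<Rightarrow> relax_state"
    and n :: nat
  assumes "M > 0" "\<Delta>t > 0" "\<Delta>x > 0"
    and "equation_of_state p s T"
    and "density_average rhobar"
    and "\<And>i. aL n i \<ge> bL n i \<and> bL n i > 0"
    and "\<And>i. aR n i \<ge> bR n i \<and> bR n i > 0"
    and "\<And>i. WL n i = equilibrium p M (\<omega> n i) (\<Phi> i) (aL n i) (bL n i)"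
    and "\<And>i. WR n i = equilibrium p M (\<omega> n (i + 1)) (\<Phi> (i + 1)) (aR n i) (bR n i)"
    and "\<And>i. \<omega> n i \<in> phase_space M"
    and "\<And>i. mass_density (euler_part (W_star_L M rhobar (WL n i) (WR n i))) > 0"
    and "\<And>i. mass_density (euler_part (W_star_R M rhobar (WL n i) (WR n i))) > 0"
    and "\<And>i. internal_energy M (euler_part (W_star_L M rhobar (WL n i) (WR n i))) > 0"
    and "\<And>i. internal_energy M (euler_part (W_star_R M rhobar (WL n i) (WR n i))) > 0"
    and "\<And>i. subcharacteristic p M (WL n i)"
    and "\<And>i. subcharacteristic p M (W_star_L M rhobar (WL n i) (WR n i))"
    and "\<And>i. subcharacteristic p M (W_star_R M rhobar (WL n i) (WR n i))"
    and "\<And>i. subcharacteristic p M (WR n i)"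
    and "\<And>i I J. strictly_convex_on {0<..} (fIJ p (aL n i) (bL n i) I J)"
    and "\<And>i I J. strictly_convex_on {0<..} (fIJ p (aR n i) (bR n i) I J)"
    and "CFL M \<Delta>t \<Delta>x (\<omega> n) (aL n) (aR n)"
    and "\<And>i. \<omega> (Suc n) i = scheme_update p M rhobar \<Delta>t \<Delta>x \<Phi> (\<omega> n) (WL n) (WR n) i"
  shows "\<forall>i. internal_energy M (\<omega> (Suc n) i) > 0"
proof
  fix i
  have rp: "riemann_problem M p rhobar (\<omega> n i) (\<omega> n (i + 1)) (\<Phi> i) (\<Phi> (i + 1))
      (aL n i) (bL n i) (aR n i) (bR n i) (WL n i) (WR n i)" for i
    using assms(1,6-14) by unfold_locales (auto simp: phase_space_def)
  interpret R: riemann_problem M p rhobar "\<omega> n i" "\<omega> n (i + 1)" "\<Phi> i" "\<Phi> (i + 1)"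
    "aL n i" "bL n i" "aR n i" "bR n i" "WL n i" "WR n i"
    by (rule rp)
  interpret L: riemann_problem M p rhobar "\<omega> n (i - 1)" "\<omega> n i" "\<Phi> (i - 1)" "\<Phi> i"
    "aL n (i - 1)" "bL n (i - 1)" "aR n (i - 1)" "bR n (i - 1)" "WL n (i - 1)" "WR n (i - 1)"
    using rp[of "i - 1"] by simp
  \<comment> \<open>This is the time step over the half-cell width, so the CFL bound
    \<open>1 / 2\<close> becomes the bound 1 required of the half-cell averages.\<close>
  define c where "c = 2 * (\<Delta>t / \<Delta>x)"
  have c: "c \<ge> 0"
    using assms(2,3) by (simp add: c_def)
  have cfl: "\<Delta>t / \<Delta>x * max \<bar>velocity (\<omega> n i) - a / (M * mass_density (\<omega> n i))\<bar>
      \<bar>velocity (\<omega> n i) + a / (M * mass_density (\<omega> n i))\<bar> \<le> 1 / 2"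
    if "a \<in> {aL n i, aR n (i - 1)}" for a
    using assms(21) that unfolding CFL_def by blast
  have bound: "c * \<bar>x\<bar> \<le> 1" if "\<Delta>t / \<Delta>x * max \<bar>y\<bar> \<bar>z\<bar> \<le> 1 / 2" "x = y \<or> x = z" for x y z
  proof -
    have "\<Delta>t / \<Delta>x * \<bar>x\<bar> \<le> \<Delta>t / \<Delta>x * max \<bar>y\<bar> \<bar>z\<bar>"
      using assms(2,3) that(2) by (intro mult_left_mono) auto
    with that(1) have "2 * (\<Delta>t / \<Delta>x * \<bar>x\<bar>) \<le> 1"
      by linarith
    then show ?thesis
      by (simp only: c_def mult.assoc)
  qed
  \<comment> \<open>\<open>HL\<close> averages the right part of the fan at \<open>i - 1/2\<close>
    over the left half of the cell; \<open>HR\<close> averages the left part of the fan at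
    \<open>i + 1/2\<close> over the right half.\<close>
  define HL where "HL = \<omega> n i + c *\<^sub>R (L.flux - euler_flux p M (\<omega> n i)
    - (if v_star M rhobar (WL n (i - 1)) (WR n (i - 1)) < 0 then 0 else L.source))"
  define HR where "HR = \<omega> n i + c *\<^sub>R (euler_flux p M (\<omega> n i) - R.flux
    - (if v_star M rhobar (WL n i) (WR n i) < 0 then R.source else 0))"
  have "HL \<in> phase_space M"
    unfolding HL_def
    by (rule L.right_half_average[OF c bound[OF cfl[of "aR n (i - 1)"]]]) (simp_all add: L.sigma_eq)
  moreover have "HR \<in> phase_space M"
    unfolding HR_def
    by (rule R.left_half_average[OF c bound[OF cfl[of "aL n i"]]]) (simp_all add: R.sigma_eq)
  ultimately have "(1 / 2) *\<^sub>R HL + (1 / 2) *\<^sub>R HR \<in> phase_space M"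
    by (intro convexD convex_phase_space) auto
  \<comment> \<open>In the mean, the exact fluxes of the cell state cancel; the interface fluxes and
    the two downwind sources remain.\<close>
  moreover have "(1 / 2) *\<^sub>R HL + (1 / 2) *\<^sub>R HR = \<omega> (Suc n) i"
  proof -
    define k where "k = \<Delta>t / \<Delta>x"
    define SL where "SL = (if v_star M rhobar (WL n (i - 1)) (WR n (i - 1)) < 0 then 0 else L.source)"
    define SR where "SR = (if v_star M rhobar (WL n i) (WR n i) < 0 then R.source else 0)"
    have scale: "(y / \<Delta>x) *\<^sub>R z = (1 / \<Delta>x) *\<^sub>R (y *\<^sub>R z)" for y and z :: euler_state
      by simp
    have "\<omega> (Suc n) i = \<omega> n i - k *\<^sub>R (R.flux - L.flux)
        + (\<Delta>t / 2) *\<^sub>R ((1 / \<Delta>x) *\<^sub>R (- 2 *\<^sub>R SL) + (1 / \<Delta>x) *\<^sub>R (- 2 *\<^sub>R SR))"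
      unfolding assms(22) scheme_update_def scale[of "\<Phi> i - \<Phi> (i - 1)"]
        scale[of "\<Phi> (i + 1) - \<Phi> i"] L.source_plus_eq R.source_minus_eq
        L.numerical_flux_eq R.numerical_flux_eq SL_def SR_def k_def ..
    also have "\<dots> = \<omega> n i - k *\<^sub>R (R.flux - L.flux) - k *\<^sub>R SL - k *\<^sub>R SR"
      by (simp add: k_def scaleR_add_right scaleR_diff_right)
    also have "\<dots> = (1 / 2) *\<^sub>R HL + (1 / 2) *\<^sub>R HR"
    proof -
      have half: "(1 / 2) *\<^sub>R x + (1 / 2) *\<^sub>R x = x" for x :: euler_state
        by (simp flip: scaleR_add_left)
      have "(1 / 2) *\<^sub>R HL + (1 / 2) *\<^sub>R HR = ((1 / 2) *\<^sub>R \<omega> n i + (1 / 2) *\<^sub>R \<omega> n i)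
          + k *\<^sub>R (L.flux - euler_flux p M (\<omega> n i) - SL)
          + k *\<^sub>R (euler_flux p M (\<omega> n i) - R.flux - SR)"
        unfolding HL_def HR_def SL_def[symmetric] SR_def[symmetric]
        by (simp add: c_def k_def scaleR_add_right scaleR_diff_right)
      then show ?thesis
        unfolding half by (simp add: algebra_simps)
    qed
    finally show ?thesis ..
  qed
  ultimately show "internal_energy M (\<omega> (Suc n) i) > 0"
    by (simp add: phase_space_def)
qed

end
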